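(* Let $G$ be a graph in which all vertices have odd degree, and which contains exactly $p$ hamiltonian cycles, where $p$ is a prime number. Then $G$ is $3$-connected.
   Context: Graphs are finite and simple; cycles are regarded as subgraphs. Connectivity means vertex-connectivity. *)

theory Defs
  imports
    "Graph_Theory.Graph_Theory"
    "HOL-Computational_Algebra.Primes"
begin

text \<open>
  A finite simple graph is a \<^locale>\<open>pair_graph\<close>: a finite, loop-free, symmetric digraph whose
  arcs are pairs of vertices.  An edge \<open>uv\<close> is the pair of arcs \<open>(u, v)\<close> and \<open>(v, u)\<close>, so the
  degree of a vertex is its \<^const>\<open>out_degree\<close>.
\<close>

text \<open>
  A cycle is regarded as a graph, not as a walk: different starting points and the two
  orientations of a closed walk give the same cycle.  The bound on the length excludes the closed
  walk \<open>u, v, u\<close>, which \<^const>\<open>pre_digraph.cycle\<close> accepts.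
\<close>

definition cycle_graph :: "'a pair_pre_digraph \<Rightarrow> bool" where
  "cycle_graph C \<longleftrightarrow>
     (\<exists>w. pre_digraph.cycle (with_proj C) w \<and> 3 \<le> length w \<and>
          pverts C = fst ` set w \<and> parcs C = set w \<union> (set w)\<inverse>)"

definition hamiltonian_cycles :: "'a pair_pre_digraph \<Rightarrow> 'a pair_pre_digraph set" where
  "hamiltonian_cycles G = {C. cycle_graph C \<and> spanning (with_proj C) (with_proj G)}"

text \<open>
  The usual convention for vertex-connectivity: more than \<open>k\<close> vertices, and deleting fewer than
  \<open>k\<close> of them never disconnects the graph.
\<close>

definition k_connected :: "nat \<Rightarrow> 'a pair_pre_digraph \<Rightarrow> bool" where
  "k_connected k G \<longleftrightarrow>
     k < card (pverts G) \<and>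
     (\<forall>X \<subseteq> pverts G. card X < k \<longrightarrow> connected (with_proj G \<restriction> (pverts G - X)))"

end

theory Submission
  imports Defs
begin

text \<open>
  The number of hamiltonian cycles factors along a cut pair, and each factor is even.

  Suppose that deleting \<open>u \<noteq> v\<close> separates the remaining vertices into nonempty sets \<open>A\<close> and \<open>B\<close>
  with no edge between them.  A hamiltonian cycle then crosses from \<open>A\<close> to \<open>B\<close> only at \<open>u\<close> and
  \<open>v\<close>, so it is a path from \<open>u\<close> to \<open>v\<close> through all of \<open>A\<close> followed by a path from \<open>v\<close> back to
  \<open>u\<close> through all of \<open>B\<close>.  The two paths can be chosen independently, whence the number of
  hamiltonian cycles is a product \<open>a * b\<close> (\<open>card_hamiltonian_cycles_cut_pair\<close>).

  Every vertex of \<open>A\<close> has all its neighbours in \<open>A \<union> {u, v}\<close>, hence odd degree there.  Under this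
  condition Thomason's lollipop argument shows that the number \<open>a\<close> of hamiltonian paths between
  \<open>u\<close> and \<open>v\<close> is even, whatever the degrees of \<open>u\<close> and \<open>v\<close> are
  (\<open>even_card_paths_through\<close>): the rotations of hamiltonian paths of \<open>A \<union> {u}\<close> that end in \<open>u\<close>
  form an auxiliary graph, in which the paths of odd degree are exactly those that extend to \<open>v\<close>,
  and a finite graph has an even number of vertices of odd degree.  The same holds for \<open>b\<close>, and a
  product of two even numbers is not prime.

  Cuts with fewer than two vertices are impossible in any hamiltonian graph, because a cycle minus
  at most one vertex contains a path through everything that is left.  Finally there are at least
  four vertices: a cycle has three, and a graph with all degrees odd has even order.
\<close>

section \<open>Handshaking\<close>

lemma even_card_odd_degree:
  assumes "finite S"
    and "\<And>x y. x \<in> S \<Longrightarrow> y \<in> S \<Longrightarrow> R x y \<Longrightarrow> R y x"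
    and "\<And>x. x \<in> S \<Longrightarrow> \<not> R x x"
  shows "even (card {x \<in> S. odd (card {y \<in> S. R x y})})"
proof -
  have "even (\<Sum>x\<in>S. card {y \<in> S. R x y})"
    using assms
  proof (induction S rule: finite_induct)
    case (insert a S)
    have row: "card {y \<in> insert a S. R x y} = card {y \<in> S. R x y} + of_bool (R x a)" if "x \<in> S" for x
    proof (cases "R x a")
      case True
      then have "{y \<in> insert a S. R x y} = insert a {y \<in> S. R x y}" by auto
      then show ?thesis using True insert.hyps by simp
    next
      case False
      then have "{y \<in> insert a S. R x y} = {y \<in> S. R x y}" by auto
      then show ?thesis using False by simp
    qed
    have new: "{y \<in> insert a S. R a y} = {x \<in> S. R x a}"
      using insert.prems by auto
    have "(\<Sum>x\<in>S. of_bool (R x a)) = card {x \<in> S. R x a}"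
      using insert.hyps(1) by (simp add: of_bool_def sum.If_cases Int_def)
    moreover have "(\<Sum>x\<in>S. card {y \<in> insert a S. R x y})
        = (\<Sum>x\<in>S. card {y \<in> S. R x y} + of_bool (R x a))"
      using row by (intro sum.cong refl)
    ultimately have "(\<Sum>x\<in>insert a S. card {y \<in> insert a S. R x y})
        = 2 * card {x \<in> S. R x a} + (\<Sum>x\<in>S. card {y \<in> S. R x y})"
      using insert.hyps unfolding sum.insert[OF insert.hyps] new by (simp add: sum.distrib)
    moreover have "even (\<Sum>x\<in>S. card {y \<in> S. R x y})"
      using insert.IH insert.prems by blast
    ultimately show ?case by simp
  qed simp
  then show ?thesis using assms(1) by (simp add: even_sum_iff)
qed

section \<open>Arcs of vertex lists\<close>

lemma vwalk_arcs_split: "vwalk_arcs (xs @ y # zs) = vwalk_arcs (xs @ [y]) @ vwalk_arcs (y # zs)"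
  by (cases "xs = []") (simp_all add: vwalk_arcs_append)

lemma set_vwalk_arcs_rev: "set (vwalk_arcs (rev xs)) = (set (vwalk_arcs xs))\<inverse>"
proof (induction xs)
  case (Cons x xs)
  then show ?case
    by (cases xs) (auto simp: vwalk_arcs_split[of _ _ "[x]"])
qed simp

lemma set_vwalk_arcs_subset: "(x, y) \<in> set (vwalk_arcs xs) \<Longrightarrow> x \<in> set xs \<and> y \<in> set xs"
  by (induction xs rule: vwalk_arcs.induct) auto

section \<open>The parity of the number of hamiltonian paths between two vertices\<close>

text \<open>
  The hamiltonian paths from \<open>u\<close> to \<open>v\<close> in the graph induced on \<open>A \<union> {u, v}\<close>, given by their
  interior vertices.  If \<open>A\<close> is nonempty and contains neither end, the arc \<open>(u, v)\<close> cannot occur on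
  such a path.
\<close>

definition paths_through :: "'a rel \<Rightarrow> 'a \<Rightarrow> 'a \<Rightarrow> 'a set \<Rightarrow> 'a list set" where
  "paths_through E u v A =
     {xs. distinct xs \<and> set xs = A \<and> set (vwalk_arcs (u # xs @ [v])) \<subseteq> E}"

text \<open>
  Rotation in the sense of Posa, with the moving end at the head of the list: a new edge joins
  the head to the vertex at position \<open>i\<close>, and the old edge that leads to that vertex is removed.
\<close>

definition rotate_path :: "nat \<Rightarrow> 'a list \<Rightarrow> 'a list" where
  "rotate_path i L = rev (take i L) @ drop i L"

text \<open>
  The prefix that is reversed keeps its length, so the same rotation undoes itself.  This makes
  the auxiliary graph on paths undirected.
\<close>

lemma rotate_path_invol: "rotate_path i (rotate_path i L) = L"
proof -
  have "length (rev (take i L)) = min i (length L)" by simp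
  then show ?thesis
    by (cases "i \<le> length L") (simp_all add: rotate_path_def)
qed

lemma length_rotate_path [simp]: "length (rotate_path i L) = length L"
  by (cases "i \<le> length L") (simp_all add: rotate_path_def)

text \<open>
  The new end of the path tells which rotation was made: distinct rotations of a path without
  repeated vertices are distinct, and none with \<open>i \<ge> 2\<close> is trivial.
\<close>

lemma hd_rotate_path: "0 < i \<Longrightarrow> i < length L \<Longrightarrow> hd (rotate_path i L) = L ! (i - 1)"
  by (cases L) (simp_all add: rotate_path_def hd_rev last_conv_nth min_def)

lemma set_vwalk_arcs_rotate_path:
  assumes "0 < i" "i < length L"
  shows "set (vwalk_arcs (rotate_path i L)) =
    insert (L ! 0, L ! i) ((set (vwalk_arcs (take i L)))\<inverse> \<union> set (vwalk_arcs (drop i L)))"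
proof -
  have "take i L \<noteq> []" "drop i L \<noteq> []" using assms by auto
  moreover have "last (rev (take i L)) = L ! 0" "hd (drop i L) = L ! i"
    using assms by (cases L; simp add: last_rev hd_drop_conv_nth)+
  ultimately show ?thesis
    using assms by (auto simp: rotate_path_def vwalk_arcs_append set_vwalk_arcs_rev)
qed

text \<open>
  Thomason's lollipop argument.  The auxiliary graph \<open>R\<close> lives on the set \<open>S\<close> of hamiltonian paths
  of \<open>A \<union> {u}\<close> that end in \<open>u\<close>.  A path with head \<open>y\<close> has one rotation for each neighbour of \<open>y\<close>
  in \<open>A \<union> {u}\<close> except for the second vertex of the path, so its degree in \<open>R\<close> is one less than the
  degree of \<open>y\<close> in \<open>A \<union> {u}\<close>.  Since \<open>y\<close> has odd degree in \<open>A \<union> {u, v}\<close>, the degree in \<open>R\<close> is odd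
  precisely when \<open>y\<close> is adjacent to \<open>v\<close>, that is, when the path extends to one from \<open>v\<close> to \<open>u\<close>.
\<close>

lemma even_card_paths_through:
  assumes "sym E" and "irrefl E" and "finite A" and "A \<noteq> {}"
    and "u \<notin> A" and "v \<notin> A" and "u \<noteq> v"
    and odd: "\<And>a. a \<in> A \<Longrightarrow> odd (card {b \<in> insert u (insert v A). (a, b) \<in> E})"
  shows "even (card (paths_through E v u A))"
proof -
  define S where "S = {L. distinct L \<and> set L = insert u A \<and> last L = u \<and> set (vwalk_arcs L) \<subseteq> E}"
  define R where "R L L' \<longleftrightarrow> (\<exists>i. 2 \<le> i \<and> i < length L \<and> L' = rotate_path i L)" for L L' :: "'a list"
  have len: "length L = Suc (card A)" if "L \<in> S" for L
    using that assms distinct_card[of L] by (simp add: S_def)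
  have cA: "card A > 0" using assms by (simp add: card_gt_0_iff)
  have "finite S"
  proof (rule finite_subset)
    show "S \<subseteq> {L. set L \<subseteq> insert u A \<and> length L = Suc (card A)}"
      using len by (auto simp: S_def)
    show "finite {L. set L \<subseteq> insert u A \<and> length L = Suc (card A)}"
      using assms by (intro finite_lists_length_eq) simp
  qed
  have Rsym: "R L' L" if "R L L'" for L L' :: "'a list"
    using that by (auto simp: R_def rotate_path_invol)
  have Rirr: "\<not> R L L" if "L \<in> S" for L
  proof
    assume "R L L"
    then obtain i where i: "2 \<le> i" "i < length L" "rotate_path i L = L" by (auto simp: R_def)
    then have "L ! (i - 1) = L ! 0" using hd_rotate_path[of i L] by (cases L) auto
    moreover have "distinct L" using that by (simp add: S_def)
    ultimately show False using i nth_eq_iff_index_eq[of L "i - 1" 0] by (cases L) auto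
  qed
  have deg: "odd (card {L' \<in> S. R L L'}) \<longleftrightarrow> (v, hd L) \<in> E" if L: "L \<in> S" for L
  proof -
    define y where "y = L ! 0"
    define I where "I = {i. 2 \<le> i \<and> i < length L \<and> (y, L ! i) \<in> E}"
    have dL: "distinct L" "set L = insert u A" "last L = u" "set (vwalk_arcs L) \<subseteq> E"
      using L by (auto simp: S_def)
    have ln: "length L \<ge> 2" using len[OF L] cA by simp
    then obtain z r where Lzr: "L = y # z # r"
      unfolding y_def by (cases L; cases "tl L") auto
    have "u \<in> set (z # r)" using dL(3) Lzr last_in_set[of "z # r"] by simp
    then have "y \<noteq> u" using dL(1) Lzr by auto
    then have yA: "y \<in> A" using dL(2) Lzr by auto
    have rot: "rotate_path i L \<in> S \<longleftrightarrow> (y, L ! i) \<in> E" if i: "2 \<le> i" "i < length L" for i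
    proof -
      have "set (rotate_path i L) = set (take i L @ drop i L)"
        unfolding rotate_path_def by (simp only: set_append set_rev)
      then have s: "set (rotate_path i L) = set L" by simp
      have d: "distinct (rotate_path i L)"
        using dL(1) s by (metis card_distinct distinct_card length_rotate_path)
      have l: "last (rotate_path i L) = last L" using i by (simp add: rotate_path_def)
      have "set (vwalk_arcs (take i L)) \<subseteq> E" "set (vwalk_arcs (drop i L)) \<subseteq> E"
        using dL(4) set_vwalk_arcs_append1[of "take i L" "drop i L"]
          set_vwalk_arcs_append2[of "drop i L" "take i L"] by auto
      then have "(set (vwalk_arcs (take i L)))\<inverse> \<union> set (vwalk_arcs (drop i L)) \<subseteq> E"
        using \<open>sym E\<close> by (auto dest: symD)
      then show ?thesis
        using i s d l dL by (simp add: S_def set_vwalk_arcs_rotate_path y_def)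
    qed
    have "{L' \<in> S. R L L'} = (\<lambda>i. rotate_path i L) ` I"
      using rot by (auto simp: R_def I_def)
    moreover have "inj_on (\<lambda>i. rotate_path i L) I"
    proof (rule inj_onI)
      fix i j assume ij: "i \<in> I" "j \<in> I" "rotate_path i L = rotate_path j L"
      then have "L ! (i - 1) = L ! (j - 1)"
        using hd_rotate_path[of i L] hd_rotate_path[of j L] by (auto simp: I_def)
      then have "i - 1 = j - 1"
        using ij dL(1) nth_eq_iff_index_eq[of L "i - 1" "j - 1"] by (auto simp: I_def)
      then show "i = j" using ij by (auto simp: I_def)
    qed
    ultimately have c1: "card {L' \<in> S. R L L'} = card I" by (simp add: card_image)
    \<comment> \<open>The second vertex \<open>z\<close> is a neighbour of \<open>y\<close> that yields no rotation; this is the shift by one.\<close>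
    have "{b \<in> insert u A. (y, b) \<in> E} = insert z ((\<lambda>i. L ! i) ` I)"
    proof (intro set_eqI iffI)
      fix b assume b: "b \<in> {b \<in> insert u A. (y, b) \<in> E}"
      then have "b \<in> set L" using dL(2) by simp
      then obtain i where i: "i < length L" "b = L ! i" by (auto simp: in_set_conv_nth)
      have "b \<noteq> y" using b \<open>irrefl E\<close> by (auto simp: irrefl_def)
      then have "i \<noteq> 0" using i by (cases "i = 0") (auto simp: y_def)
      show "b \<in> insert z ((\<lambda>i. L ! i) ` I)"
      proof (cases "i = 1")
        case True then show ?thesis using i Lzr by simp
      next
        case False then show ?thesis using i b \<open>i \<noteq> 0\<close> by (auto simp: I_def)
      qed
    next
      fix b assume "b \<in> insert z ((\<lambda>i. L ! i) ` I)"
      then have "b \<in> set L" "(y, b) \<in> E"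
        using dL(4) Lzr by (auto simp: I_def)
      then show "b \<in> {b \<in> insert u A. (y, b) \<in> E}" using dL(2) by simp
    qed
    moreover have "z \<notin> (\<lambda>i. L ! i) ` I"
    proof
      assume "z \<in> (\<lambda>i. L ! i) ` I"
      then obtain i where "i \<in> I" "L ! i = L ! 1" using Lzr by auto
      then show False using dL(1) ln nth_eq_iff_index_eq[of L i 1] by (auto simp: I_def)
    qed
    moreover have "inj_on (\<lambda>i. L ! i) I"
      using dL(1) by (auto simp: inj_on_def I_def nth_eq_iff_index_eq)
    moreover have "finite I" by (simp add: I_def)
    ultimately have c2: "card {b \<in> insert u A. (y, b) \<in> E} = Suc (card I)"
      by (simp add: card_image)
    have "{b \<in> insert u (insert v A). (y, b) \<in> E}
        = (if (y, v) \<in> E then insert v {b \<in> insert u A. (y, b) \<in> E} else {b \<in> insert u A. (y, b) \<in> E})"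
      by auto
    then have "card {b \<in> insert u (insert v A). (y, b) \<in> E} = Suc (card I) + of_bool ((y, v) \<in> E)"
      using c2 assms by simp
    then have "odd (card I) \<longleftrightarrow> (y, v) \<in> E" using odd[OF yA] by (auto split: if_splits)
    moreover have "(y, v) \<in> E \<longleftrightarrow> (v, hd L) \<in> E" using \<open>sym E\<close> Lzr by (auto dest: symD)
    ultimately show ?thesis using c1 by simp
  qed
  have "bij_betw (\<lambda>xs. xs @ [u]) (paths_through E v u A) {L \<in> S. odd (card {L' \<in> S. R L L'})}"
  proof (rule bij_betwI')
    fix xs assume xs: "xs \<in> paths_through E v u A"
    then have "xs @ [u] \<in> S" "(v, hd (xs @ [u])) \<in> E"
      using assms by (auto simp: paths_through_def S_def)
    then show "xs @ [u] \<in> {L \<in> S. odd (card {L' \<in> S. R L L'})}"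
      using deg by simp
  next
    fix L assume "L \<in> {L \<in> S. odd (card {L' \<in> S. R L L'})}"
    then have L: "L \<in> S" "(v, hd L) \<in> E" using deg by auto
    have "L \<noteq> []" using L by (auto simp: S_def)
    then obtain xs where xs: "L = xs @ [u]" using L by (cases L rule: rev_cases) (auto simp: S_def)
    have "insert u (set xs) = insert u A" "u \<notin> set xs" using L xs by (auto simp: S_def)
    then have "set xs = A" using \<open>u \<notin> A\<close> by (metis insert_ident)
    then have "xs \<in> paths_through E v u A"
      using L xs \<open>A \<noteq> {}\<close> by (auto simp: paths_through_def S_def)
    then show "\<exists>xs\<in>paths_through E v u A. L = xs @ [u]" using xs by blast
  qed auto
  then have "card (paths_through E v u A) = card {L \<in> S. odd (card {L' \<in> S. R L L'})}"
    by (rule bij_betw_same_card)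
  moreover have "even (card {L \<in> S. odd (card {L' \<in> S. R L L'})})"
    using \<open>finite S\<close> Rsym Rirr by (intro even_card_odd_degree)
  ultimately show ?thesis by simp
qed

section \<open>Hamiltonian cycles as vertex lists\<close>

lemma fst_set_vwalk_arcs: "fst ` set (vwalk_arcs (xs @ [y])) = set xs"
proof (induction xs)
  case (Cons x xs)
  then show ?case by simp
qed simp

lemma vwalk_arcs_pawalk_verts:
  "pcas u es v \<Longrightarrow> vwalk_arcs (pawalk_verts u es) = es"
proof (induction es arbitrary: u)
  case (Cons e es)
  then show ?case by (cases es) auto
qed simp

lemma pawalk_verts_ends:
  "pcas u es v \<Longrightarrow> hd (pawalk_verts u es) = u \<and> last (pawalk_verts u es) = v \<and> length (pawalk_verts u es) = Suc (length es)"
proof (induction es arbitrary: u)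
  case (Cons e es)
  then have "pawalk_verts (snd e) es \<noteq> []" by (cases es) auto
  then show ?case using Cons by simp
qed simp

lemma pcas_vwalk_arcs:
  "ws \<noteq> [] \<Longrightarrow> pcas (hd ws) (vwalk_arcs ws) (last ws) \<and> pawalk_verts (hd ws) (vwalk_arcs ws) = ws"
  by (induction ws rule: vwalk_arcs.induct) auto

definition sym_arcs_of :: "'a list \<Rightarrow> 'a rel" where
  "sym_arcs_of xs = set (vwalk_arcs xs) \<union> (set (vwalk_arcs xs))\<inverse>"

definition cycle_of :: "'a list \<Rightarrow> 'a pair_pre_digraph" where
  "cycle_of ws = \<lparr>pverts = set ws, parcs = sym_arcs_of (ws @ [hd ws])\<rparr>"

text \<open>
  Vertex lists are easier to cut and reverse than the arc walks by which cycles are defined.  The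
  closed walk of a list \<open>ws\<close> is \<open>ws @ [hd ws]\<close>, and taking arcs is inverse to taking vertices.
\<close>

lemma cycle_graph_iff:
  "cycle_graph C \<longleftrightarrow> (\<exists>ws. distinct ws \<and> 3 \<le> length ws \<and> C = cycle_of ws)"
proof
  assume "cycle_graph C"
  then obtain es u where es: "pcas u es u" "distinct (tl (pawalk_verts u es))" "3 \<le> length es"
    "pverts C = fst ` set es" "parcs C = set es \<union> (set es)\<inverse>"
    by (auto simp: cycle_graph_def pre_digraph.cycle_def pre_digraph.awalk_def
        cas_with_proj_eq awalk_verts_with_proj_eq)
  define ws where "ws = butlast (pawalk_verts u es)"
  note ends = pawalk_verts_ends[OF es(1)]
  have ne: "pawalk_verts u es \<noteq> []" "length ws = length es" using ends by (auto simp: ws_def)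
  then have vs: "pawalk_verts u es = ws @ [u]"
    using ends append_butlast_last_id[of "pawalk_verts u es"] by (simp add: ws_def)
  obtain r where r: "ws = u # r" using vs ends ne es(3) by (cases ws) auto
  have arcs: "vwalk_arcs (ws @ [u]) = es" using vwalk_arcs_pawalk_verts[OF es(1)] vs by simp
  have "distinct ws" using es(2) vs r by auto
  moreover have "C = cycle_of ws"
    using es arcs fst_set_vwalk_arcs[of ws u] r by (simp add: cycle_of_def sym_arcs_of_def)
  ultimately show "\<exists>ws. distinct ws \<and> 3 \<le> length ws \<and> C = cycle_of ws"
    using ne es(3) by auto
next
  assume "\<exists>ws. distinct ws \<and> 3 \<le> length ws \<and> C = cycle_of ws"
  then obtain ws where ws: "distinct ws" "3 \<le> length ws" "C = cycle_of ws" by blast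
  define es where "es = vwalk_arcs (ws @ [hd ws])"
  obtain u r where r: "ws = u # r" using ws(2) by (cases ws) auto
  have w: "pcas u es u" "pawalk_verts u es = ws @ [u]"
    using pcas_vwalk_arcs[of "ws @ [u]"] r by (auto simp: es_def)
  have "length es = length ws"
    using pawalk_verts_ends[OF w(1)] w(2) by simp
  then show "cycle_graph C"
    using w ws r fst_set_vwalk_arcs[of ws u] unfolding cycle_graph_def pre_digraph.cycle_def pre_digraph.awalk_def
    by (intro exI[of _ es] conjI exI[of _ u])
      (auto simp: cas_with_proj_eq awalk_verts_with_proj_eq cycle_of_def sym_arcs_of_def es_def)
qed

lemma vwalk_arcs_rotate:
  "set (vwalk_arcs (u # bs @ as @ [u])) = set (vwalk_arcs (as @ u # bs @ [hd (as @ [u])]))"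
proof (cases as)
  case (Cons h t)
  then show ?thesis
    using vwalk_arcs_split[of "u # bs" h "t @ [u]"] vwalk_arcs_split[of "h # t" u "bs @ [h]"] by auto
qed simp

text \<open>
  A cycle can be listed from any of its vertices.  Fixing the starting point leaves only the
  orientation undetermined.
\<close>

lemma hamiltonian_cycles_from:
  assumes "pair_graph G" and "u \<in> pverts G"
  shows "C \<in> hamiltonian_cycles G \<longleftrightarrow>
    (\<exists>zs. distinct (u # zs) \<and> 2 \<le> length zs \<and> set (u # zs) = pverts G \<and>
       set (vwalk_arcs (u # zs @ [u])) \<subseteq> parcs G \<and> C = cycle_of (u # zs))"
proof
  assume "C \<in> hamiltonian_cycles G"
  then obtain ws where ws: "distinct ws" "3 \<le> length ws" "C = cycle_of ws"
    and sp: "pverts G = pverts C" "parcs C \<subseteq> parcs G"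
    by (auto simp: hamiltonian_cycles_def cycle_graph_iff spanning_def subgraph_def)
  have "u \<in> set ws" using assms sp ws by (simp add: cycle_of_def)
  then obtain as bs where ab: "ws = as @ u # bs" by (auto simp: in_set_conv_decomp)
  have hd: "hd ws = hd (as @ [u])" using ab by (cases as) auto
  have "set (vwalk_arcs (u # (bs @ as) @ [u])) = set (vwalk_arcs (ws @ [hd ws]))"
    using vwalk_arcs_rotate[of u bs as] ab hd by simp
  moreover from this have "C = cycle_of (u # bs @ as)"
    using ws ab by (auto simp: cycle_of_def sym_arcs_of_def)
  moreover have "set (vwalk_arcs (ws @ [hd ws])) \<subseteq> parcs G"
    using sp ws by (auto simp: cycle_of_def sym_arcs_of_def)
  ultimately show "\<exists>zs. distinct (u # zs) \<and> 2 \<le> length zs \<and> set (u # zs) = pverts G \<and>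
       set (vwalk_arcs (u # zs @ [u])) \<subseteq> parcs G \<and> C = cycle_of (u # zs)"
    using ws ab sp by (intro exI[of _ "bs @ as"]) (auto simp: cycle_of_def)
next
  interpret pair_graph G by fact
  assume "\<exists>zs. distinct (u # zs) \<and> 2 \<le> length zs \<and> set (u # zs) = pverts G \<and>
       set (vwalk_arcs (u # zs @ [u])) \<subseteq> parcs G \<and> C = cycle_of (u # zs)"
  then obtain zs where zs: "distinct (u # zs)" "2 \<le> length zs" "set (u # zs) = pverts G"
    "set (vwalk_arcs (u # zs @ [u])) \<subseteq> parcs G" "C = cycle_of (u # zs)" by blast
  have "cycle_graph C"
    unfolding cycle_graph_iff using zs by (intro exI[of _ "u # zs"]) auto
  moreover have sub: "parcs C \<subseteq> parcs G" and V: "pverts C = pverts G"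
    using zs arcs_symmetric by (auto simp: cycle_of_def sym_arcs_of_def)
  moreover have "wf_digraph (with_proj C)"
    using sub V by unfold_locales (auto dest!: subsetD[OF sub] dest: in_arcsD1 in_arcsD2)
  ultimately show "C \<in> hamiltonian_cycles G"
    using wf_digraph by (auto simp: hamiltonian_cycles_def spanning_def subgraph_def compatible_def)
qed

section \<open>Counting hamiltonian cycles along a cut pair\<close>

lemma walk_on_one_side:
  assumes "set (vwalk_arcs xs) \<subseteq> E" and "sym E" and "set xs \<subseteq> A \<union> B"
    and "\<And>a b. a \<in> A \<Longrightarrow> b \<in> B \<Longrightarrow> (a, b) \<notin> E"
  shows "set xs \<subseteq> A \<or> set xs \<subseteq> B"
  using assms(1,3)
proof (induction xs rule: vwalk_arcs.induct)
  case (3 x y xs)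
  then have "set (y # xs) \<subseteq> A \<or> set (y # xs) \<subseteq> B" by auto
  moreover have "(x, y) \<in> E" "(y, x) \<in> E" using 3 \<open>sym E\<close> by (auto dest: symD)
  ultimately show ?case using 3 assms(4) by auto
qed auto

lemma sym_arcs_of_Cons_Cons:
  "sym_arcs_of (x # y # xs) = {(x, y), (y, x)} \<union> sym_arcs_of (y # xs)"
  by (auto simp: sym_arcs_of_def)

lemma sym_arcs_of_subset: "(x, y) \<in> sym_arcs_of xs \<Longrightarrow> x \<in> set xs \<and> y \<in> set xs"
  by (auto simp: sym_arcs_of_def dest: set_vwalk_arcs_subset)

text \<open>
  From the first vertex, the set of edges leaves no choice at any step: the first vertex lies on one
  edge only, and removing that edge leaves the edges of the remaining path.
\<close>

lemma path_determined_by_sym_arcs: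
  assumes "distinct (x # xs)" and "distinct (x # ys)" and "sym_arcs_of (x # xs) = sym_arcs_of (x # ys)"
  shows "xs = ys"
  using assms
proof (induction xs arbitrary: x ys)
  case Nil
  then show ?case by (cases ys) (auto simp: sym_arcs_of_def)
next
  case (Cons y xs)
  obtain z zs where ys: "ys = z # zs"
    using Cons.prems by (cases ys) (auto simp: sym_arcs_of_def)
  have out: "(x, w) \<notin> sym_arcs_of (y # xs)" "(w, x) \<notin> sym_arcs_of (y # xs)"
    "(x, w) \<notin> sym_arcs_of (z # zs)" "(w, x) \<notin> sym_arcs_of (z # zs)" for w
    using Cons.prems ys by (auto dest!: sym_arcs_of_subset)
  have eq: "{(x, y), (y, x)} \<union> sym_arcs_of (y # xs) = {(x, z), (z, x)} \<union> sym_arcs_of (z # zs)"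
    using Cons.prems(3) ys by (simp only: sym_arcs_of_Cons_Cons)
  have "(x, y) \<in> {(x, z), (z, x)} \<union> sym_arcs_of (z # zs)" using eq by blast
  then have "y = z" using out Cons.prems by auto
  moreover have "sym_arcs_of (y # xs) = sym_arcs_of (z # zs)"
  proof (rule set_eqI)
    fix e
    have "e \<in> sym_arcs_of (y # xs) \<longleftrightarrow>
        e \<in> {(x, y), (y, x)} \<union> sym_arcs_of (y # xs) \<and> e \<noteq> (x, y) \<and> e \<noteq> (y, x)"
      using out by auto
    also have "\<dots> \<longleftrightarrow> e \<in> sym_arcs_of (z # zs)"
      unfolding eq using out \<open>y = z\<close> by auto
    finally show "e \<in> sym_arcs_of (y # xs) \<longleftrightarrow> e \<in> sym_arcs_of (z # zs)" .
  qed
  ultimately show ?case using Cons.IH[of y zs] Cons.prems ys by simp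
qed

lemma vwalk_arcs_interior:
  assumes "(a, b) \<in> set (vwalk_arcs (x # xs @ [y]))" and "xs \<noteq> []"
  shows "a \<in> set xs \<or> b \<in> set xs"
  using assms
proof (induction xs arbitrary: x)
  case (Cons z xs)
  then show ?case by (cases xs) auto
qed simp

lemma sym_arcs_of_cycle:
  "parcs (cycle_of (u # xs @ v # ys)) = sym_arcs_of (u # xs @ [v]) \<union> sym_arcs_of (v # ys @ [u])"
  using vwalk_arcs_split[of "u # xs" v "ys @ [u]"] by (auto simp: cycle_of_def sym_arcs_of_def)

lemma cycle_of_reverse: "cycle_of (u # rev zs) = cycle_of (u # zs)"
  using set_vwalk_arcs_rev[of "u # zs @ [u]"] by (auto simp: cycle_of_def sym_arcs_of_def)

text \<open>
  Putting two paths together is a bijection onto the hamiltonian cycles.  It is injective because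
  the side \<open>A\<close> or \<open>B\<close> that an edge of the cycle meets tells from which path the edge comes, and a
  path is determined by its edges.  It is surjective because each of the two parts of a cycle
  between \<open>u\<close> and \<open>v\<close> stays on one side; listing the side \<open>A\<close> first fixes the orientation.
\<close>

theorem card_hamiltonian_cycles_cut_pair:
  assumes "pair_graph G"
    and V: "pverts G = {u, v} \<union> A \<union> B" and "u \<noteq> v" and disj: "u \<notin> A \<union> B" "v \<notin> A \<union> B" "A \<inter> B = {}"
    and ne: "A \<noteq> {}" "B \<noteq> {}"
    and sep: "\<And>a b. a \<in> A \<Longrightarrow> b \<in> B \<Longrightarrow> (a, b) \<notin> parcs G"
  shows "card (hamiltonian_cycles G) =
    card (paths_through (parcs G) u v A) * card (paths_through (parcs G) v u B)"
proof -
  interpret pair_graph G by fact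
  have symE: "sym (parcs G)" using arcs_symmetric by (auto intro: symI)
  let ?f = "\<lambda>(xs, ys). cycle_of (u # xs @ v # ys)"
  let ?P = "paths_through (parcs G) u v A \<times> paths_through (parcs G) v u B"
  have from_u: "C \<in> hamiltonian_cycles G \<longleftrightarrow>
    (\<exists>zs. distinct (u # zs) \<and> 2 \<le> length zs \<and> set (u # zs) = pverts G \<and>
       set (vwalk_arcs (u # zs @ [u])) \<subseteq> parcs G \<and> C = cycle_of (u # zs))" for C
    using assms(1) V by (intro hamiltonian_cycles_from) auto
  have "bij_betw ?f ?P (hamiltonian_cycles G)"
  proof (rule bij_betw_imageI)
    have A_part: "sym_arcs_of (u # xs @ [v]) = {(a, b) \<in> parcs (?f (xs, ys)). a \<notin> B \<and> b \<notin> B}"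
     and B_part: "sym_arcs_of (v # ys @ [u]) = {(a, b) \<in> parcs (?f (xs, ys)). a \<notin> A \<and> b \<notin> A}"
      if "(xs, ys) \<in> ?P" for xs ys
    proof -
      have xs: "set xs = A" and ys: "set ys = B" using that by (auto simp: paths_through_def)
      then have "a \<in> A \<or> b \<in> A" if "(a, b) \<in> sym_arcs_of (u # xs @ [v])" for a b
        using that ne vwalk_arcs_interior[of _ _ u xs v] by (fastforce simp: sym_arcs_of_def)
      moreover have "a \<in> B \<or> b \<in> B" if "(a, b) \<in> sym_arcs_of (v # ys @ [u])" for a b
        using that ys ne vwalk_arcs_interior[of _ _ v ys u] by (fastforce simp: sym_arcs_of_def)
      moreover have "a \<notin> B \<and> b \<notin> B" if "(a, b) \<in> sym_arcs_of (u # xs @ [v])" for a b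
        using sym_arcs_of_subset[OF that] xs disj by auto
      moreover have "a \<notin> A \<and> b \<notin> A" if "(a, b) \<in> sym_arcs_of (v # ys @ [u])" for a b
        using sym_arcs_of_subset[OF that] ys disj by auto
      ultimately show "sym_arcs_of (u # xs @ [v]) = {(a, b) \<in> parcs (?f (xs, ys)). a \<notin> B \<and> b \<notin> B}"
        "sym_arcs_of (v # ys @ [u]) = {(a, b) \<in> parcs (?f (xs, ys)). a \<notin> A \<and> b \<notin> A}"
        unfolding prod.case sym_arcs_of_cycle by blast+
    qed
    show "inj_on ?f ?P"
    proof (rule inj_onI, clarify)
      fix xs ys xs' ys'
      assume in1: "xs \<in> paths_through (parcs G) u v A" "ys \<in> paths_through (parcs G) v u B"
        and in2: "xs' \<in> paths_through (parcs G) u v A" "ys' \<in> paths_through (parcs G) v u B"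
        and eq: "cycle_of (u # xs @ v # ys) = cycle_of (u # xs' @ v # ys')"
      have "sym_arcs_of (u # xs @ [v]) = sym_arcs_of (u # xs' @ [v])"
        using A_part[of xs ys] A_part[of xs' ys'] in1 in2 eq by simp
      moreover have "sym_arcs_of (v # ys @ [u]) = sym_arcs_of (v # ys' @ [u])"
        using B_part[of xs ys] B_part[of xs' ys'] in1 in2 eq by simp
      ultimately have "xs @ [v] = xs' @ [v]" "ys @ [u] = ys' @ [u]"
        using in1 in2 disj \<open>u \<noteq> v\<close>
          path_determined_by_sym_arcs[of u "xs @ [v]" "xs' @ [v]"]
          path_determined_by_sym_arcs[of v "ys @ [u]" "ys' @ [u]"]
        by (auto simp: paths_through_def)
      then show "xs = xs' \<and> ys = ys'" by simp
    qed
    show "?f ` ?P = hamiltonian_cycles G"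
    proof (intro set_eqI iffI)
      fix C assume "C \<in> ?f ` ?P"
      then obtain xs ys where C: "C = cycle_of (u # xs @ v # ys)"
        and xs: "distinct xs" "set xs = A" "set (vwalk_arcs (u # xs @ [v])) \<subseteq> parcs G"
        and ys: "distinct ys" "set ys = B" "set (vwalk_arcs (v # ys @ [u])) \<subseteq> parcs G"
        by (auto simp: paths_through_def)
      have "set (vwalk_arcs (u # (xs @ v # ys) @ [u])) \<subseteq> parcs G"
        using vwalk_arcs_split[of "u # xs" v "ys @ [u]"] xs ys by simp
      moreover have "2 \<le> length (xs @ v # ys)" using ne xs by (cases xs) auto
      ultimately show "C \<in> hamiltonian_cycles G"
        unfolding from_u using C xs ys V disj \<open>u \<noteq> v\<close>
        by (intro exI[of _ "xs @ v # ys"]) auto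
    next
      fix C assume "C \<in> hamiltonian_cycles G"
      then obtain zs where zs: "distinct (u # zs)" "set (u # zs) = pverts G"
       "set (vwalk_arcs (u # zs @ [u])) \<subseteq> parcs G" "C = cycle_of (u # zs)"
        unfolding from_u by blast
      have "v \<in> set zs" using zs V \<open>u \<noteq> v\<close> by auto
      then obtain xs ys where xy: "zs = xs @ v # ys" by (auto simp: in_set_conv_decomp)
      have arcs: "set (vwalk_arcs (u # xs @ [v])) \<subseteq> parcs G" "set (vwalk_arcs (v # ys @ [u])) \<subseteq> parcs G"
        using zs(3) vwalk_arcs_split[of "u # xs" v "ys @ [u]"] xy by auto
      have walks: "set (vwalk_arcs xs) \<subseteq> parcs G" "set (vwalk_arcs ys) \<subseteq> parcs G"
        using arcs set_vwalk_arcs_append1[of xs "[v]"] set_vwalk_arcs_append1[of ys "[u]"]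
          set_vwalk_arcs_cons[of "xs @ [v]" u] set_vwalk_arcs_cons[of "ys @ [u]" v] by blast+
      have un: "set xs \<union> set ys = A \<union> B"
      proof -
        have "set xs \<union> set ys = pverts G - {u, v}" using zs(1) xy unfolding zs(2)[symmetric] by auto
        then show ?thesis using V disj by auto
      qed
      have sub: "set xs \<subseteq> A \<union> B" "set ys \<subseteq> A \<union> B" using un by auto
      have "set xs \<subseteq> A \<or> set xs \<subseteq> B"
        by (rule walk_on_one_side[OF walks(1) symE sub(1)]) (rule sep)
      moreover have "set ys \<subseteq> A \<or> set ys \<subseteq> B"
        by (rule walk_on_one_side[OF walks(2) symE sub(2)]) (rule sep)
      ultimately have "set xs = A \<and> set ys = B \<or> set xs = B \<and> set ys = A"
        using un ne disj(3) by auto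
      then consider "set xs = A" "set ys = B" | "set xs = B" "set ys = A"
        by blast
      then show "C \<in> ?f ` ?P"
      proof cases
        case 1
        then have "(xs, ys) \<in> ?P" using zs(1) xy arcs by (auto simp: paths_through_def)
        then show ?thesis using zs(4) xy by force
      next
        \<comment> \<open>The cycle is listed with the side \<open>B\<close> first, so the opposite orientation is used.\<close>
        case 2
        have "set (vwalk_arcs (u # rev ys @ [v])) \<subseteq> parcs G" "set (vwalk_arcs (v # rev xs @ [u])) \<subseteq> parcs G"
          using arcs symE set_vwalk_arcs_rev[of "v # ys @ [u]"] set_vwalk_arcs_rev[of "u # xs @ [v]"]
          by (auto dest: symD)
        then have "(rev ys, rev xs) \<in> ?P" using 2 zs(1) xy by (auto simp: paths_through_def)
        moreover have "C = ?f (rev ys, rev xs)" using zs(4) xy cycle_of_reverse[of u zs] by simp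
        ultimately show ?thesis by blast
      qed
    qed
  qed
  then show ?thesis
    using bij_betw_same_card card_cartesian_product by metis
qed

section \<open>Connectivity\<close>

lemma not_connected_imp_separation:
  assumes "W \<noteq> {}" and "\<not> connected (with_proj G \<restriction> W)"
  obtains A B where "A \<union> B = W" "A \<inter> B = {}" "A \<noteq> {}" "B \<noteq> {}"
    "\<And>a b. a \<in> A \<Longrightarrow> b \<in> B \<Longrightarrow> (a, b) \<notin> parcs G"
proof -
  \<comment> \<open>\<open>A\<close> consists of the vertices that are reachable from a vertex \<open>x\<close> which does not reach all of \<open>W\<close>.\<close>
  let ?H = "with_proj (mk_symmetric (with_proj G \<restriction> W))"
  obtain x y where xy: "x \<in> W" "y \<in> W" "\<not> x \<rightarrow>\<^sup>*\<^bsub>?H\<^esub> y"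
    using assms by (auto simp: connected_def strongly_connected_def mk_symmetric_def)
  define A where "A = {w \<in> W. x \<rightarrow>\<^sup>*\<^bsub>?H\<^esub> w}"
  have "(a, b) \<notin> parcs G" if "a \<in> A" "b \<in> W - A" for a b
  proof
    assume "(a, b) \<in> parcs G"
    then have "(a, b) \<in> arcs_ends ?H"
      using that by (force simp: A_def mk_symmetric_def)
    then have "x \<rightarrow>\<^sup>*\<^bsub>?H\<^esub> b"
      using that rtrancl_on_into_rtrancl_on[of x a "verts ?H" "arcs_ends ?H" b]
      by (auto simp: A_def reachable_def mk_symmetric_def)
    then show False using that by (simp add: A_def)
  qed
  moreover have "x \<in> A"
    using xy by (simp add: A_def reachable_def mk_symmetric_def)
  moreover have "y \<in> W - A" using xy by (simp add: A_def)
  ultimately show thesis using that[of A "W - A"] by (auto simp: A_def)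
qed

lemma even_card_verts_if_odd_degrees:
  assumes "pair_graph G" and "\<forall>v \<in> pverts G. odd (card {w \<in> pverts G. (v, w) \<in> parcs G})"
  shows "even (card (pverts G))"
proof -
  interpret pair_graph G by fact
  have "even (card {x \<in> pverts G. odd (card {y \<in> pverts G. (x, y) \<in> parcs G})})"
    using pair_finite_verts arcs_symmetric no_loops' by (intro even_card_odd_degree) auto
  moreover have "{x \<in> pverts G. odd (card {y \<in> pverts G. (x, y) \<in> parcs G})} = pverts G"
    using assms(2) by auto
  ultimately show ?thesis by simp
qed

lemma out_degree_eq_card_neighbours:
  assumes "pair_graph G"
  shows "out_degree (with_proj G) v = card {w \<in> pverts G. (v, w) \<in> parcs G}"
proof -
  interpret pair_graph G by fact
  have "out_arcs (with_proj G) v = Pair v ` {w \<in> pverts G. (v, w) \<in> parcs G}"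
    by (auto simp: out_arcs_def dest: in_arcsD2)
  then show ?thesis by (simp add: out_degree_def card_image inj_on_def)
qed

theorem theorem3p12:
  fixes G :: "'a pair_pre_digraph" and p :: nat
  assumes "pair_graph G"
    and "\<forall>v \<in> pverts G. odd (out_degree (with_proj G) v)"
    and "prime p"
    and "card (hamiltonian_cycles G) = p"
  shows "k_connected 3 G"
proof -
  interpret pair_graph G by fact
  have symE: "sym (parcs G)" using arcs_symmetric by (auto intro: symI)
  have irrE: "irrefl (parcs G)" using no_loops' by (auto simp: irrefl_def)
  have deg: "odd (card {w \<in> pverts G. (v, w) \<in> parcs G})" if "v \<in> pverts G" for v
    using assms(1,2) that by (simp add: out_degree_eq_card_neighbours)
  have "hamiltonian_cycles G \<noteq> {}" using assms(3,4) by auto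
  then obtain C where C: "C \<in> hamiltonian_cycles G" by blast
  then obtain u0 where "u0 \<in> pverts G"
    by (auto simp: hamiltonian_cycles_def cycle_graph_iff cycle_of_def spanning_def)
      (metis hd_in_set list.size(3) not_numeral_le_zero)
  have path: "\<exists>zs. distinct (u # zs) \<and> 2 \<le> length zs \<and> set (u # zs) = pverts G \<and>
      set (vwalk_arcs (u # zs)) \<subseteq> parcs G" if u: "u \<in> pverts G" for u
  proof -
    obtain zs where "distinct (u # zs)" "2 \<le> length zs" "set (u # zs) = pverts G"
      "set (vwalk_arcs ((u # zs) @ [u])) \<subseteq> parcs G"
      using C hamiltonian_cycles_from[OF assms(1) u, of C] by auto
    then show ?thesis using set_vwalk_arcs_append1[of "u # zs" "[u]"] by blast
  qed
  have "3 \<le> card (pverts G)"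
    using path[OF \<open>u0 \<in> pverts G\<close>] distinct_card by fastforce
  moreover have "even (card (pverts G))"
    using assms(1) deg by (intro even_card_verts_if_odd_degrees) auto
  ultimately have card: "3 < card (pverts G)" by (cases "card (pverts G) = 3") auto
  have "connected (with_proj G \<restriction> (pverts G - X))" if X: "X \<subseteq> pverts G" "card X < 3" for X
  proof (rule ccontr)
    assume nc: "\<not> connected (with_proj G \<restriction> (pverts G - X))"
    have "finite X" using X pair_finite_verts finite_subset by blast
    have "pverts G - X \<noteq> {}"
    proof
      assume "pverts G - X = {}"
      then have "pverts G = X" using X by blast
      then show False using card X by simp
    qed
    then obtain A B where AB: "A \<union> B = pverts G - X" "A \<inter> B = {}" "A \<noteq> {}" "B \<noteq> {}"
      and sep: "\<And>a b. a \<in> A \<Longrightarrow> b \<in> B \<Longrightarrow> (a, b) \<notin> parcs G"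
      using not_connected_imp_separation[OF _ nc] by blast
    have one_side: False if "set xs = pverts G - X" "set (vwalk_arcs xs) \<subseteq> parcs G" for xs
      using walk_on_one_side[OF that(2) symE, of A B] sep that(1) AB by blast
    consider "X = {}" | u where "X = {u}" | u v where "X = {u, v}" "u \<noteq> v"
    proof -
      have "card X = 0 \<or> card X = 1 \<or> card X = 2" using X by linarith
      then show thesis using that \<open>finite X\<close> by (auto simp: card_1_singleton_iff card_2_iff)
    qed
    then show False
    proof cases
      case 1
      then show False using path[OF \<open>u0 \<in> pverts G\<close>] one_side by (metis Diff_empty)
    next
      case (2 u)
      then obtain zs where zs: "distinct (u # zs)" "set (u # zs) = pverts G" "set (vwalk_arcs (u # zs)) \<subseteq> parcs G"
        using X path by blast
      have "set zs = pverts G - X" using zs(1) 2 unfolding zs(2)[symmetric] by auto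
      moreover have "set (vwalk_arcs zs) \<subseteq> parcs G"
        using zs(3) set_vwalk_arcs_cons[of zs u] by blast
      ultimately show False by (rule one_side)
    next
      case (3 u v)
      have V: "pverts G = {u, v} \<union> A \<union> B" and disj: "u \<notin> A \<union> B" "v \<notin> A \<union> B"
        using 3 X AB by blast+
      have sep': "\<And>b a. b \<in> B \<Longrightarrow> a \<in> A \<Longrightarrow> (b, a) \<notin> parcs G"
        using sep arcs_symmetric by blast
      have fin: "finite A" "finite B" using V pair_finite_verts by auto
      have "odd (card {b \<in> insert v (insert u A). (a, b) \<in> parcs G})" if "a \<in> A" for a
      proof -
        have "{b \<in> insert v (insert u A). (a, b) \<in> parcs G} = {b \<in> pverts G. (a, b) \<in> parcs G}"
          using V sep that by auto
        then show ?thesis using deg[of a] V that by simp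
      qed
      then have evA: "even (card (paths_through (parcs G) u v A))"
        using symE irrE fin AB disj 3 by (intro even_card_paths_through) auto
      have "odd (card {a \<in> insert u (insert v B). (b, a) \<in> parcs G})" if "b \<in> B" for b
      proof -
        have "{a \<in> insert u (insert v B). (b, a) \<in> parcs G} = {a \<in> pverts G. (b, a) \<in> parcs G}"
          using V sep' that by auto
        then show ?thesis using deg[of b] V that by simp
      qed
      then have evB: "even (card (paths_through (parcs G) v u B))"
        using symE irrE fin AB disj 3 by (intro even_card_paths_through) auto
      have "p = card (paths_through (parcs G) u v A) * card (paths_through (parcs G) v u B)"
        using card_hamiltonian_cycles_cut_pair[OF assms(1) V 3(2) disj AB(2-4) sep] assms(4) by simp
      then show False
        using \<open>prime p\<close> evA evB prime_product[of "card (paths_through (parcs G) u v A)"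
          "card (paths_through (parcs G) v u B)"] by auto
    qed
  qed
  then show ?thesis using card by (auto simp: k_connected_def)
qed

end
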